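(* There exists an abelian $16$-power free morphism $h:\Sigma^*\to\Sigma^*$ over the binary alphabet $\Sigma=\{a,b\}$ with an infinite fixed point $\Omega_3\in\Sigma^{\mathbb{N}}$ such that: (i) $aaa$ is not a factor of $\Omega_3$; (ii) $bb$ is not a factor of $\Omega_3$; (iii) $\Omega_3$ is abelian $16$-power free.
   Context: $\Sigma^*$ is the free monoid of finite words over $\Sigma$, with empty word $\epsilon$. A morphism is a monoid homomorphism $h:\Sigma^*\to\Sigma^*$; it extends to infinite words letter by letter, and an infinite word $\Omega$ is a fixed point of $h$ if $h(\Omega)=\Omega$. A factor of a word is a contiguous finite subword. The Parikh vector $\psi(u)$ of a finite word $u$ records the number of occurrences of each letter in $u$. A word $u$ (finite or infinite) is abelian $k$-power free if whenever $u=xv_1\cdots v_ky$ with $\psi(v_1)=\cdots=\psi(v_k)$, one has $v_1=\cdots=v_k=\epsilon$. A morphism $h$ is abelian $n$-power free if $h(u)$ is abelian $n$-power free for every abelian $n$-power free word $u$. *)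

theory Defs
  imports Main "HOL-Library.Stream"
begin

datatype letter = A | B

definition word_morphism :: "('a list \<Rightarrow> 'b list) \<Rightarrow> bool" where
  "word_morphism h \<longleftrightarrow> h [] = [] \<and> (\<forall>u v. h (u @ v) = h u @ h v)"

text \<open>
  \<open>inf_image h s w\<close> says that \<open>w\<close> is the concatenation \<open>h(s\<^sub>0) h(s\<^sub>1) h(s\<^sub>2) \<dots>\<close>.
  It is a relation because a morphism may erase letters, in which case this concatenation
  can be finite; the second conjunct says that it is infinite.
\<close>

definition inf_image :: "('a list \<Rightarrow> 'b list) \<Rightarrow> 'a stream \<Rightarrow> 'b stream \<Rightarrow> bool" where
  "inf_image h s w \<longleftrightarrow>
     (\<forall>n. \<exists>t. w = concat (map (\<lambda>c. h [c]) (stake n s)) @- t) \<and>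
     (\<forall>m. \<exists>n. m \<le> length (concat (map (\<lambda>c. h [c]) (stake n s))))"

definition inf_fixed_point :: "('a list \<Rightarrow> 'a list) \<Rightarrow> 'a stream \<Rightarrow> bool" where
  "inf_fixed_point h s \<longleftrightarrow> inf_image h s s"

definition inf_factor :: "'a list \<Rightarrow> 'a stream \<Rightarrow> bool" where
  "inf_factor u s \<longleftrightarrow> (\<exists>x y. s = x @- u @- y)"

definition parikh :: "'a list \<Rightarrow> 'a \<Rightarrow> nat" where
  "parikh u c = count_list u c"

text \<open>In the next two definitions, \<open>vs = [v\<^sub>1, \<dots>, v\<^sub>k]\<close>.\<close>

definition abelian_power_free :: "nat \<Rightarrow> 'a list \<Rightarrow> bool" where
  "abelian_power_free k u \<longleftrightarrow>
     (\<forall>x vs y. u = x @ concat vs @ y \<and> length vs = k \<and>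
        (\<forall>v\<in>set vs. \<forall>v'\<in>set vs. parikh v = parikh v') \<longrightarrow> (\<forall>v\<in>set vs. v = []))"

definition inf_abelian_power_free :: "nat \<Rightarrow> 'a stream \<Rightarrow> bool" where
  "inf_abelian_power_free k s \<longleftrightarrow>
     (\<forall>x vs y. s = x @- concat vs @- y \<and> length vs = k \<and>
        (\<forall>v\<in>set vs. \<forall>v'\<in>set vs. parikh v = parikh v') \<longrightarrow> (\<forall>v\<in>set vs. v = []))"

definition abelian_power_free_morphism :: "nat \<Rightarrow> ('a list \<Rightarrow> 'b list) \<Rightarrow> bool" where
  "abelian_power_free_morphism n h \<longleftrightarrow>
     word_morphism h \<and> (\<forall>u. abelian_power_free n u \<longrightarrow> abelian_power_free n (h u))"

lemma word_morphism_concat: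
  assumes "word_morphism h"
  shows "concat (map (\<lambda>c. h [c]) u) = h u"
proof (induction u)
  case Nil
  then show ?case using assms by (simp add: word_morphism_def)
next
  case (Cons c u)
  then show ?case using assms by (metis append_Cons append_Nil concat.simps(2) list.simps(9) word_morphism_def)
qed

lemma inf_image_unique:
  assumes "inf_image h s w" "inf_image h s w'"
  shows "w = w'"
proof -
  have "w !! i = w' !! i" for i
  proof -
    obtain n where n: "Suc i \<le> length (concat (map (\<lambda>c. h [c]) (stake n s)))"
      using assms(1) unfolding inf_image_def by blast
    obtain t where t: "w = concat (map (\<lambda>c. h [c]) (stake n s)) @- t"
      using assms(1) unfolding inf_image_def by blast
    obtain t' where t': "w' = concat (map (\<lambda>c. h [c]) (stake n s)) @- t'"
      using assms(2) unfolding inf_image_def by blast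
    show ?thesis using n unfolding t t' by (simp del: length_concat map_concat)
  qed
  then show ?thesis by (metis ext stream_smap_nats)
qed

end

theory Submission
  imports Defs "HOL-Library.Sublist" "HOL-Library.Multiset" "HOL-Number_Theory.Cong"
begin

text \<open>
  Weigh the letters by \<open>A \<mapsto> 1\<close>, \<open>B \<mapsto> 11\<close> modulo \<open>17\<close>. Both images
  \<open>h(A) = AABAABAABAB\<close> and \<open>h(B) = AABABABABABABAB\<close> have weight \<open>0\<close>, and no prefix of an image
  \<open>h(u)\<close> has weight \<open>7\<close>. The \<open>17\<close> cut points of an abelian \<open>16\<close>-th power in \<open>h(u)\<close> have weights in
  arithmetic progression, so, \<open>17\<close> being prime, these weights are all equal. Cut points of equal weight
  can be moved simultaneously to block boundaries, all of them by the same Parikh vector, and the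
  abelian power lifts to \<open>u\<close> (Dekking's method). The images are products of \<open>AB\<close> and \<open>AAB\<close>,
  which excludes \<open>AAA\<close> and \<open>BB\<close>.
\<close>

section \<open>Dekking's criterion\<close>

lemma parikh_simps [simp]:
  "parikh [] x = 0"
  "parikh (c # u) x = (if c = x then 1 else 0) + parikh u x"
  "parikh (u @ v) x = parikh u x + parikh v x"
  by (simp_all add: parikh_def)

lemma parikh_eq_iff_mset_eq: "parikh u = parikh v \<longleftrightarrow> mset u = mset v"
  by (simp add: parikh_def multiset_eq_iff fun_eq_iff count_mset)

lemma parikh_eq_Nil_iff: "parikh u = parikh [] \<longleftrightarrow> u = []"
  by (simp add: parikh_eq_iff_mset_eq)

lemma word_morphism_Cons:
  assumes "word_morphism h"
  shows "h (c # u) = h [c] @ h u"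
  using assms by (metis append_Cons append_Nil word_morphism_def)

text \<open>Locates a cut point relative to the blocks. A cut at the right end of a block is a
  boundary, hence \<open>s\<close> is nonempty in the second case; \<open>p\<close> may be empty, so
  the cases overlap.\<close>

lemma prefix_of_image_cases:
  assumes h: "word_morphism h" and "prefix P (h u)"
  obtains (boundary) w where "prefix w u" "P = h w"
  | (inside) w c p s where "prefix (w @ [c]) u" "P = h w @ p" "h [c] = p @ s" "s \<noteq> []"
  using assms(2)
proof (induction u arbitrary: P thesis)
  case Nil
  then show ?case
    by (metis h prefix_Nil prefix_order.refl word_morphism_def)
next
  case (Cons a u)
  have "prefix P (h [a] @ h u)"
    using Cons.prems(3) word_morphism_Cons[OF h] by metis
  then consider s where "h [a] = P @ s" "s \<noteq> []" | Q where "P = h [a] @ Q" "prefix Q (h u)"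
  proof -
    assume P: "prefix P (h [a] @ h u)"
      and partial: "\<And>s. h [a] = P @ s \<Longrightarrow> s \<noteq> [] \<Longrightarrow> thesis"
      and full: "\<And>Q. P = h [a] @ Q \<Longrightarrow> prefix Q (h u) \<Longrightarrow> thesis"
    consider s where "h [a] = P @ s" | Q where "P = h [a] @ Q" "prefix Q (h u)"
      using P unfolding prefix_append by (auto simp: prefix_def[of P])
    then show thesis
    proof cases
      case (1 s)
      then show thesis
        using partial full[of "[]"] by (cases "s = []") simp_all
    qed (rule full)
  qed
  then show ?case
  proof cases
    case (1 s)
    have "h [] = []" using h by (simp add: word_morphism_def)
    then show ?thesis
      using Cons.prems(2)[of "[]" a P s] 1 by simp
  next
    case (2 Q)
    show ?thesis
    proof (rule Cons.IH[of Q])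
      show "prefix Q (h u)" by fact
    next
      fix w assume "prefix w u" "Q = h w"
      then show ?thesis
        using Cons.prems(1)[of "a # w"] 2 word_morphism_Cons[OF h, of a w] by simp
    next
      fix w c p s
      assume "prefix (w @ [c]) u" "Q = h w @ p" "h [c] = p @ s" "s \<noteq> []"
      then show ?thesis
        using Cons.prems(2)[of "a # w" c p s] 2 word_morphism_Cons[OF h, of a w] by simp
    qed
  qed
qed

definition weight :: "('a \<Rightarrow> int) \<Rightarrow> 'a list \<Rightarrow> int" where
  "weight f u = sum_list (map f u)"

lemma weight_simps [simp]:
  "weight f [] = 0"
  "weight f (c # u) = f c + weight f u"
  "weight f (u @ v) = weight f u + weight f v"
  by (simp_all add: weight_def)

lemma weight_eq_of_parikh_eq:
  assumes "parikh u = parikh v"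
  shows "weight f u = weight f v"
proof -
  have "weight f w = sum_mset (image_mset f (mset w))" for w
    by (induction w) simp_all
  then show ?thesis
    using assms by (simp add: parikh_eq_iff_mset_eq)
qed

text \<open>Abelian power freeness phrased through the \<open>k + 1\<close> cut points
  \<open>w 0, ..., w k\<close> instead of the \<open>k\<close> factors; lifted powers arise in this
  form.\<close>

lemma abelian_power_of_prefixes:
  assumes free: "abelian_power_free k u"
    and w: "\<And>i. i \<le> k \<Longrightarrow> prefix (w i) u"
    and z: "\<And>i. i < k \<Longrightarrow> w (Suc i) = w i @ z i"
    and eq: "\<And>i j. i < k \<Longrightarrow> j < k \<Longrightarrow> parikh (z i) = parikh (z j)"
    and "i < k"
  shows "z i = []"
proof -
  have *: "j \<le> k \<Longrightarrow> w j = w 0 @ concat (map z [0..<j])" for j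
    by (induction j) (simp_all add: z)
  obtain y where "u = w k @ y"
    using w[of k] by (auto simp: prefix_def)
  then have "u = w 0 @ concat (map z [0..<k]) @ y"
    using *[of k] by simp
  moreover have "\<forall>v\<in>set (map z [0..<k]). \<forall>v'\<in>set (map z [0..<k]). parikh v = parikh v'"
    by (auto intro!: eq)
  moreover have "length (map z [0..<k]) = k"
    by simp
  ultimately have "\<forall>v\<in>set (map z [0..<k]). v = []"
    using free unfolding abelian_power_free_def by blast
  then show ?thesis
    using \<open>i < k\<close> by simp
qed

text \<open>With \<open>e\<close> inverse to \<open>d\<close> modulo the prime \<open>q\<close>, the
  index \<open>e * (r - s)\<close> reduced modulo \<open>q\<close> works.\<close>

lemma arithmetic_progression_hits_residue:
  fixes s d r :: int
  assumes "prime q" "\<not> int q dvd d"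
  obtains i where "i < q" "(s + int i * d) mod int q = r mod int q"
proof -
  have "coprime d (int q)"
    using assms by (metis coprime_commute prime_imp_coprime prime_nat_int_transfer)
  then obtain e where "[d * e = 1] (mod int q)"
    using cong_solve_coprime_int by blast
  then have "[d * e * (r - s) = 1 * (r - s)] (mod int q)"
    by (rule cong_scalar_right)
  moreover define j where "j = (e * (r - s)) mod int q"
  ultimately have "[d * j = r - s] (mod int q)"
    by (simp add: cong_def mod_mult_right_eq mult.assoc)
  then have "[s + j * d = r] (mod int q)"
    by (metis add.commute cong_add_lcancel diff_add_cancel mult.commute)
  moreover have "q > 0"
    using assms(1) by (rule prime_gt_0_nat)
  then have "0 \<le> j" "j < int q"
    by (simp_all add: j_def)
  ultimately show ?thesis
    using that[of "nat j"] by (simp add: cong_def)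
qed

text \<open>
  The assumption \<open>cut\<close> says that \<open>\<delta> g\<close> is the common displacement, measured from a nearby block
  boundary, of all cut points of weight \<open>g\<close>: either from the left end or from the right end of the block.
\<close>

theorem dekking_criterion:
  fixes h :: "'a list \<Rightarrow> 'b list" and f :: "'b \<Rightarrow> int" and \<delta> :: "int \<Rightarrow> 'b \<Rightarrow> int"
  assumes h: "word_morphism h"
    and inj: "\<And>u v. parikh (h u) = parikh (h v) \<Longrightarrow> parikh u = parikh v"
    and prime: "prime (Suc k)"
    and zero: "\<And>c. int (Suc k) dvd weight f (h [c])"
    and cut: "\<And>c p s. h [c] = p @ s \<Longrightarrow> s \<noteq> [] \<Longrightarrow> weight f p mod int (Suc k) \<noteq> r \<and>
      ((\<forall>x. int (parikh p x) = \<delta> (weight f p mod int (Suc k)) x) \<or>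
       (\<forall>x. - int (parikh s x) = \<delta> (weight f p mod int (Suc k)) x))"
    and \<delta>_0: "\<And>x. \<delta> 0 x = 0"
    and r: "0 < r" "r < int (Suc k)"
  shows "abelian_power_free_morphism k h"
proof -
  define q where "q = int (Suc k)"
  have h_Nil: "h [] = []" and h_append: "h (u @ v) = h u @ h v" for u v
    using h by (simp_all add: word_morphism_def)
  have weight_h: "q dvd weight f (h w)" for w
  proof (induction w)
    case (Cons c w)
    then show ?case
      using zero[of c] word_morphism_Cons[OF h, of c w] by (simp add: q_def)
  qed (simp add: h_Nil)
  \<comment> \<open>Every cut point rounds to a block boundary with an error that depends only on
    its weight modulo \<open>q\<close>. Boundaries themselves have weight 0, which is why
    \<open>r\<close> is positive and \<open>\<delta> 0\<close> vanishes.\<close>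
  have round: "weight f P mod q \<noteq> r \<and>
      (\<exists>w. prefix w u \<and> (\<forall>x. int (parikh P x) = int (parikh (h w) x) + \<delta> (weight f P mod q) x))"
    if "prefix P (h u)" for P u
    using h that
  proof (cases rule: prefix_of_image_cases)
    case (boundary w)
    then show ?thesis
      using weight_h[of w] r \<delta>_0 by (auto simp: dvd_eq_mod_eq_0)
  next
    case (inside w c p s)
    have P: "weight f P mod q = weight f p mod q"
      using weight_h[of w] inside(2) by (simp add: mod_add_eq dvd_eq_mod_eq_0 flip: mod_add_left_eq)
    have "prefix w u"
      using inside(1) by (auto simp: prefix_def)
    note * = cut[OF inside(3,4), folded q_def]
    then consider "\<forall>x. int (parikh p x) = \<delta> (weight f p mod q) x"
      | "\<forall>x. - int (parikh s x) = \<delta> (weight f p mod q) x"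
      by blast
    then have "\<exists>w. prefix w u \<and>
        (\<forall>x. int (parikh P x) = int (parikh (h w) x) + \<delta> (weight f P mod q) x)"
    proof cases
      case 1
      then show ?thesis
        using \<open>prefix w u\<close> P inside(2) by (intro exI[of _ w]) simp
    next
      case 2
      \<comment> \<open>Rounding up: \<open>P\<close> is \<open>h (w @ [c])\<close> with the final
        \<open>s\<close> removed.\<close>
      then have "\<forall>x. int (parikh P x) = int (parikh (h (w @ [c])) x) + \<delta> (weight f P mod q) x"
        unfolding P using inside(2,3) by (simp add: h_append flip: 2[rule_format])
      then show ?thesis
        using inside(1) by blast
    qed
    then show ?thesis
      using * P by simp
  qed
  have "abelian_power_free k (h u)" if free: "abelian_power_free k u" for u
    unfolding abelian_power_free_def
  proof (intro allI impI, elim conjE)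
    fix x vs y
    assume hu: "h u = x @ concat vs @ y" and len: "length vs = k"
      and eq: "\<forall>v\<in>set vs. \<forall>v'\<in>set vs. parikh v = parikh v'"
    define P where "P i = x @ concat (take i vs)" for i
    have P_prefix: "prefix (P i) (h u)" for i
    proof -
      have "concat vs = concat (take i vs) @ concat (drop i vs)"
        by (metis append_take_drop_id concat_append)
      then show ?thesis
        by (simp add: hu P_def)
    qed
    have P_Suc: "P (Suc i) = P i @ vs ! i" if "i < k" for i
      using that len by (simp add: P_def take_Suc_conv_app_nth)
    have eq_nth: "parikh (vs ! i) = parikh (vs ! j)" if "i < k" "j < k" for i j
      using that eq len by simp
    define d where "d = weight f (vs ! 0)"
    have P_weight: "i \<le> k \<Longrightarrow> weight f (P i) = weight f x + int i * d" for i
    proof (induction i)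
      case 0
      then show ?case by (simp add: P_def)
    next
      case (Suc i)
      then have "weight f (vs ! i) = d"
        unfolding d_def by (intro weight_eq_of_parikh_eq eq_nth) auto
      then show ?case
        using Suc P_Suc[of i] by (simp add: algebra_simps)
    qed
    \<comment> \<open>Otherwise the \<open>k + 1 = q\<close> cut points \<open>P 0, ..., P k\<close>
      would run through all residues, including the forbidden \<open>r\<close>.\<close>
    have "q dvd d"
    proof (rule ccontr)
      assume "\<not> q dvd d"
      then obtain i where "i < Suc k" "(weight f x + int i * d) mod q = r mod q"
        using arithmetic_progression_hits_residue[OF prime] unfolding q_def by metis
      then have "weight f (P i) mod q = r"
        using P_weight[of i] r by (simp add: q_def)
      then show False
        using round[OF P_prefix] by blast
    qed
    define g where "g = weight f x mod q"
    have P_mod: "weight f (P i) mod q = g" if "i \<le> k" for i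
    proof -
    obtain e where "d = q * e"
      using \<open>q dvd d\<close> by blast
    then show ?thesis
      using P_weight[OF that] by (simp add: g_def mult.left_commute[of "int i" q])
  qed
    \<comment> \<open>Equal weights give all cut points the same displacement
      \<open>\<delta> g\<close>, which cancels in the differences taken in
      \<open>step\<close>.\<close>
    have "\<forall>i. \<exists>w. i \<le> k \<longrightarrow> prefix w u \<and>
        (\<forall>x. int (parikh (P i) x) = int (parikh (h w) x) + \<delta> g x)"
      using round[OF P_prefix] P_mod by metis
    then obtain w where w: "prefix (w i) u"
        "int (parikh (P i) x) = int (parikh (h (w i)) x) + \<delta> g x" if "i \<le> k" for i x
      by metis
    have step: "parikh (h (w (Suc i))) x = parikh (h (w i)) x + parikh (vs ! i) x" if "i < k" for i x
      using w(2)[of i x] w(2)[of "Suc i" x] that P_Suc[OF that] by simp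
    show "\<forall>v\<in>set vs. v = []"
    proof (rule ccontr)
      assume "\<not> (\<forall>v\<in>set vs. v = [])"
      then obtain v where v: "v \<in> set vs" "v \<noteq> []"
        by blast
      have nonempty: "vs ! i \<noteq> []" if "i < k" for i
        using that v eq len parikh_eq_Nil_iff by (metis nth_mem)
      \<comment> \<open>Rounding might reverse the order of two cut points. Both are prefixes of
        \<open>u\<close>, hence comparable; a reversal would make the counts of
        \<open>vs ! i\<close> at most zero in \<open>step\<close>, so \<open>vs ! i\<close> would be
        empty.\<close>
      have "\<exists>z. w (Suc i) = w i @ z" if "i < k" for i
      proof (rule ccontr)
        assume no: "\<nexists>z. w (Suc i) = w i @ z"
        have "prefix (w i) (w (Suc i)) \<or> prefix (w (Suc i)) (w i)"
          using w(1)[of i] w(1)[of "Suc i"] that by (meson Suc_leI less_imp_le prefix_same_cases)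
        with no obtain z where "w i = w (Suc i) @ z"
          by (auto simp: prefix_def)
        then have "parikh (vs ! i) x = 0" for x
          using step[OF that, of x] by (simp add: h_append)
        then have "parikh (vs ! i) = parikh []"
          by auto
        then show False
          using nonempty[OF that] by (simp add: parikh_eq_Nil_iff)
      qed
      then obtain z where z: "\<And>i. i < k \<Longrightarrow> w (Suc i) = w i @ z i"
        by metis
      have z_image: "parikh (h (z i)) = parikh (vs ! i)" if "i < k" for i
        using step[OF that] z[OF that] by (auto simp: h_append)
      have "z i = []" if "i < k" for i
        using free w(1) z _ that
      proof (rule abelian_power_of_prefixes)
        show "parikh (z i) = parikh (z j)" if "i < k" "j < k" for i j
          using inj z_image eq_nth that by metis
      qed
      moreover obtain i where "i < k"
        using v(1) len by (metis in_set_conv_nth)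
      ultimately show False
        using z_image[of i] nonempty[of i] h_Nil parikh_eq_Nil_iff by metis
    qed
  qed
  then show ?thesis
    using h by (simp add: abelian_power_free_morphism_def)
qed

section \<open>Fixed points of prolongable morphisms\<close>

text \<open>The iterates of \<open>h\<close> on \<open>a\<close> form a chain of ever longer
  prefixes, and \<open>s\<close> is their limit. The second conclusion carries properties of the
  iterates over to \<open>s\<close>.\<close>

lemma prolongable_fixed_point:
  assumes h: "word_morphism h" and nonerasing: "\<And>c. h [c] \<noteq> []"
    and a: "h [a] = a # t" "t \<noteq> []"
  obtains s where "inf_fixed_point h s" "\<And>n. \<exists>m. prefix (stake n s) ((h ^^ m) [a])"
proof -
  define W where "W m = (h ^^ m) [a]" for m
  have h_append: "h (u @ v) = h u @ h v" for u v
    using h by (simp add: word_morphism_def)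
  have h_mono: "prefix u v \<Longrightarrow> prefix (h u) (h v)" for u v
    by (auto simp: prefix_def h_append)
  have length_h: "length u \<le> length (h u)" for u
  proof (induction u)
    case (Cons c u)
    have "h (c # u) = h [c] @ h u"
      by (rule word_morphism_Cons[OF h])
    then have "length (h (c # u)) = length (h [c]) + length (h u)"
      by (metis length_append)
    moreover have "0 < length (h [c])"
      using nonerasing by (metis length_greater_0_conv)
    ultimately show ?case
      using Cons by (simp only: list.size)
  qed simp
  have W_tail: "\<exists>v. W m = a # v" for m
  proof (induction m)
    case (Suc m)
    then obtain v where "W m = a # v"
      by blast
    then show ?case
      using word_morphism_Cons[OF h, of a v] a by (simp add: W_def)
  qed (simp add: W_def)
  have W_length: "m < length (W m)" for m
  proof (induction m)
    case (Suc m)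
    obtain v where v: "W m = a # v"
      using W_tail by blast
    then have "W (Suc m) = a # t @ h v"
      using word_morphism_Cons[OF h, of a v] a by (simp add: W_def)
    then have "length (W (Suc m)) = Suc (length t + length (h v))"
      by simp
    moreover have "0 < length t"
      using a(2) by (metis length_greater_0_conv)
    moreover have "m < Suc (length v)"
      using Suc v by simp
    ultimately show ?case
      using length_h[of v] by linarith
  qed (simp add: W_def)
  have W_Suc: "prefix (W m) (W (Suc m))" for m
    by (induction m) (use a h_mono in \<open>auto simp: W_def\<close>)
  have W_mono: "prefix (W m) (W n)" if "m \<le> n" for m n
    using that by (induction rule: dec_induct) (use W_Suc prefix_order.trans in blast)+
  \<comment> \<open>The diagonal reads existing letters because \<open>W n\<close> has more than
    \<open>n\<close> of them.\<close>
  define s where "s = smap (\<lambda>n. W n ! n) nats"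
  have s_nth: "s !! i = W m ! i" if "i < length (W m)" for i m
  proof -
    have "prefix (W i) (W m) \<or> prefix (W m) (W i)"
      using W_mono by (meson linear)
    then have "W i ! i = W m ! i"
      using that W_length[of i] by (auto simp: prefix_def nth_append)
    then show ?thesis
      by (simp add: s_def)
  qed
  have stake_W: "stake (length (W m)) s = W m" for m
    by (rule nth_equalityI) (simp_all add: s_nth)
  have stake_prefix: "prefix (stake n s) (W n)" for n
    using stake_W[of n] W_length[of n]
    by (metis less_imp_le min.absorb1 take_is_prefix take_stake)
  have "inf_fixed_point h s"
    unfolding inf_fixed_point_def inf_image_def word_morphism_concat[OF h]
  proof (intro conjI allI)
    fix n
    \<comment> \<open>Applying \<open>h\<close> shifts the chain by one, and
      \<open>W (Suc n)\<close> is again a prefix of \<open>s\<close>.\<close>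
    have "prefix (h (stake n s)) (W (Suc n))"
      using h_mono[OF stake_prefix[of n]] by (simp add: W_def)
    then obtain y where "W (Suc n) = h (stake n s) @ y"
      by (auto simp: prefix_def)
    then show "\<exists>t. s = h (stake n s) @- t"
      by (metis shift_append stake_W stake_sdrop)
  next
    fix m
    show "\<exists>n. m \<le> length (h (stake n s))"
      using length_h[of "stake m s"] by auto
  qed
  then show ?thesis
    using that stake_prefix unfolding W_def by blast
qed

lemma shift_eq_stake:
  "s = u @- t \<Longrightarrow> stake (length u) s = u"
  by (simp add: stake_shift)

text \<open>Since \<open>s\<close> is its own image, the image of a long enough prefix of
  \<open>s\<close> covers any given occurrence of \<open>v\<close>. Avoidance then only has to be
  checked on finite images.\<close>

lemma inf_factor_of_fixed_point:
  assumes h: "word_morphism h" and s: "inf_fixed_point h s" and "inf_factor v s"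
  obtains u where "sublist v (h u)"
proof -
  obtain x y where "s = (x @ v) @- y"
    using assms(3) by (auto simp: inf_factor_def)
  moreover obtain n where n: "length (x @ v) \<le> length (h (stake n s))"
    using s unfolding inf_fixed_point_def inf_image_def word_morphism_concat[OF h] by blast
  moreover obtain t where "s = h (stake n s) @- t"
    using s unfolding inf_fixed_point_def inf_image_def word_morphism_concat[OF h] by blast
  ultimately have "x @ v = take (length (x @ v)) (h (stake n s))"
    by (metis min.absorb1 shift_eq_stake take_stake)
  then have "prefix (x @ v) (h (stake n s))"
    by (metis take_is_prefix)
  then have "sublist v (h (stake n s))"
    by (auto simp: prefix_def sublist_def)
  then show ?thesis
    by (rule that)
qed

lemma abelian_power_free_prefix:
  assumes "abelian_power_free k u" "prefix v u"
  shows "abelian_power_free k v"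
  using assms unfolding abelian_power_free_def prefix_def
  by (metis append.assoc)

lemma inf_abelian_power_freeI:
  assumes "\<And>n. abelian_power_free k (stake n s)"
  shows "inf_abelian_power_free k s"
  unfolding inf_abelian_power_free_def
proof (intro allI impI, elim conjE)
  fix x vs y
  assume s: "s = x @- concat vs @- y" and vs: "length vs = k"
    "\<forall>v\<in>set vs. \<forall>v'\<in>set vs. parikh v = parikh v'"
  have "stake (length (x @ concat vs)) s = x @ concat vs @ []"
    using s by (subst shift_eq_stake[of s "x @ concat vs" y]) simp_all
  then show "\<forall>v\<in>set vs. v = []"
    using assms vs unfolding abelian_power_free_def by blast
qed

text \<open>A single letter cannot fill two factors, so one of them is empty, and equal Parikh
  vectors make all of them empty.\<close>

lemma abelian_power_free_letter:
  assumes "k \<ge> 2"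
  shows "abelian_power_free k [c]"
  unfolding abelian_power_free_def
proof (intro allI impI, elim conjE)
  fix x vs y
  assume c: "[c] = x @ concat vs @ y" and vs: "length vs = k"
    "\<forall>v\<in>set vs. \<forall>v'\<in>set vs. parikh v = parikh v'"
  obtain v v' vs' where vs': "vs = v # v' # vs'"
    using vs(1) assms by (metis Suc_le_length_iff numeral_2_eq_2)
  have "length [c] = length (x @ concat vs @ y)"
    using c by simp
  then have "v = [] \<or> v' = []"
    unfolding vs' by (cases v; cases v') auto
  then have "\<exists>v\<in>set vs. parikh v = parikh []"
    using vs' by auto
  then show "\<forall>v\<in>set vs. v = []"
    using vs(2) parikh_eq_Nil_iff by metis
qed

lemma inf_abelian_power_free_fixed_point:
  fixes h :: "'a list \<Rightarrow> 'a list"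
  assumes "abelian_power_free_morphism k h" "k \<ge> 2"
    and "\<And>n. \<exists>m. prefix (stake n s) ((h ^^ m) [a])"
  shows "inf_abelian_power_free k s"
proof (rule inf_abelian_power_freeI)
  fix n
  have "abelian_power_free k ((h ^^ m) [a])" for m
  proof (induction m)
    case 0
    show ?case
      using abelian_power_free_letter[OF assms(2), of a] by simp
  next
    case (Suc m)
    then show ?case
      using assms(1) by (simp add: abelian_power_free_morphism_def)
  qed
  then show "abelian_power_free k (stake n s)"
    using assms(3)[of n] abelian_power_free_prefix by blast
qed

section \<open>The morphism\<close>

fun block :: "letter \<Rightarrow> letter list" where
  "block A = [A, A, B, A, A, B, A, A, B, A, B]"
| "block B = [A, A, B, A, B, A, B, A, B, A, B, A, B, A, B]"

definition block_map :: "letter list \<Rightarrow> letter list" where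
  "block_map u = concat (map block u)"

lemma block_map_simps [simp]:
  "block_map [] = []"
  "block_map (c # u) = block c @ block_map u"
  by (simp_all add: block_map_def)

lemma word_morphism_block_map: "word_morphism block_map"
  by (simp add: word_morphism_def block_map_def)

fun letter_weight :: "letter \<Rightarrow> int" where
  "letter_weight A = 1"
| "letter_weight B = 11"

lemma parikh_block_map:
  "parikh (block_map u) A = 7 * parikh u A + 8 * parikh u B"
  "parikh (block_map u) B = 4 * parikh u A + 7 * parikh u B"
proof (induction u)
  case (Cons c u)
  case 1 then show ?case using Cons by (cases c) simp_all
  case 2 then show ?case using Cons by (cases c) simp_all
qed simp_all

text \<open>The incidence matrix has determinant 7 * 7 - 8 * 4 = 17, which is nonzero.\<close>

lemma parikh_block_map_inj:
  assumes "parikh (block_map u) = parikh (block_map v)"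
  shows "parikh u = parikh v"
proof
  fix c
  have "7 * parikh u A + 8 * parikh u B = 7 * parikh v A + 8 * parikh v B"
    "4 * parikh u A + 7 * parikh u B = 4 * parikh v A + 7 * parikh v B"
    using assms parikh_block_map by metis+
  then have "parikh u A = parikh v A" "parikh u B = parikh v B"
    by linarith+
  then show "parikh u c = parikh v c"
    by (cases c) simp_all
qed

text \<open>The weights \<open>7\<close> and \<open>12\<close> do not occur at cut points; their entries are arbitrary.\<close>

fun displacement :: "letter \<Rightarrow> int list" where
  "displacement A = [0, 1, 2, -4, -3, -1, 0, 0, -5, 4, -2, -1, 0, 2, 3, -3, -2]"
| "displacement B = [0, 0, 0, -4, -4, -1, -1, 0, -5, 2, -2, -2, 0, 1, 1, -3, -3]"

lemma letter_forall: "(\<forall>x. P x) \<longleftrightarrow> P A \<and> P B"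
  by (metis letter.exhaust)

text \<open>A finite check over the 11 + 15 proper prefixes of the two blocks. Cuts of equal weight
  in different blocks share one entry of \<open>displacement\<close>; negative entries count letters
  still missing up to the right end of the block.\<close>

lemma block_cut:
  assumes "block_map [c] = p @ s" "s \<noteq> []"
  shows "weight letter_weight p mod 17 \<noteq> 7 \<and>
    ((\<forall>x. int (parikh p x) = displacement x ! nat (weight letter_weight p mod 17)) \<or>
     (\<forall>x. - int (parikh s x) = displacement x ! nat (weight letter_weight p mod 17)))"
proof (cases c)
  case A
  with assms show ?thesis
    by (auto simp: Cons_eq_append_conv letter_forall)
next
  case B
  with assms show ?thesis
    by (auto simp: Cons_eq_append_conv letter_forall)
qed

lemma abelian_power_free_block_map: "abelian_power_free_morphism 16 block_map"
proof (rule dekking_criterion[where r = 7])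
  show "word_morphism block_map"
    by (rule word_morphism_block_map)
  show "parikh u = parikh v" if "parikh (block_map u) = parikh (block_map v)" for u v
    using that by (rule parikh_block_map_inj)
  show "prime (Suc 16)"
    by simp
  show "int (Suc 16) dvd weight letter_weight (block_map [c])" for c
    by (cases c) simp_all
  show "weight letter_weight p mod int (Suc 16) \<noteq> 7 \<and>
      ((\<forall>x. int (parikh p x) = displacement x ! nat (weight letter_weight p mod int (Suc 16))) \<or>
       (\<forall>x. - int (parikh s x) = displacement x ! nat (weight letter_weight p mod int (Suc 16))))"
    if "block_map [c] = p @ s" "s \<noteq> []" for c p s
    using block_cut[OF that] by simp
  show "displacement x ! nat 0 = 0" for x
    by (cases x) simp_all
qed simp_all

text \<open>Controls the seam between blocks: each block ends in \<open>B\<close>, so the next one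
  must not begin with \<open>B\<close>.\<close>

lemma not_prefix_B_block_map: "\<not> prefix (B # v) (block_map u)"
proof (cases u)
  case (Cons c u)
  then show ?thesis by (cases c) simp_all
qed simp

lemma block_map_avoids:
  "\<not> sublist [A, A, A] (block_map u)" "\<not> sublist [B, B] (block_map u)"
proof (induction u)
  case (Cons c u)
  case 1 then show ?case
    using Cons by (cases c) (simp_all add: sublist_Cons_right not_prefix_B_block_map)
  case 2 then show ?case
    using Cons by (cases c) (simp_all add: sublist_Cons_right not_prefix_B_block_map)
qed simp_all

theorem theorem2p17:
  "\<exists>(h :: letter list \<Rightarrow> letter list) (\<Omega>\<^sub>3 :: letter stream).
     abelian_power_free_morphism 16 h \<and>
     inf_fixed_point h \<Omega>\<^sub>3 \<and>
     \<not> inf_factor [A, A, A] \<Omega>\<^sub>3 \<and>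
     \<not> inf_factor [B, B] \<Omega>\<^sub>3 \<and>
     inf_abelian_power_free 16 \<Omega>\<^sub>3"
proof -
  have "block_map [c] \<noteq> []" for c
    by (cases c) simp_all
  moreover have "block_map [A] = A # [A, B, A, A, B, A, A, B, A, B]"
    by simp
  ultimately obtain s where s: "inf_fixed_point block_map s"
    "\<And>n. \<exists>m. prefix (stake n s) ((block_map ^^ m) [A])"
    using prolongable_fixed_point[OF word_morphism_block_map] by (metis list.distinct(1))
  have "\<not> inf_factor [A, A, A] s" "\<not> inf_factor [B, B] s"
    using inf_factor_of_fixed_point[OF word_morphism_block_map s(1)] block_map_avoids by metis+
  moreover have "inf_abelian_power_free 16 s"
    by (rule inf_abelian_power_free_fixed_point[OF abelian_power_free_block_map _ s(2)]) simp
  ultimately show ?thesis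
    using s(1) abelian_power_free_block_map by blast
qed

end
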